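(* Let $\epsilon\in(0,1]$, let $V,A_1$ be real-valued potentials on $[a,b]$, and let $\Phi_0:[a,b]\to\mathbb C^2$ be the initial datum. For the one-dimensional semiclassical Dirac equation, both the second-order splitting scheme $S_2$ and the fourth-order compact splitting scheme $S_{4c}$ conserve the discrete mass, namely for either scheme $$\|\Phi^{n+1}\|_{l_2}=\|\Phi^n\|_{l_2}=\|\Phi^0\|_{l_2},\qquad n\ge0;$$ equivalently, $\|\Phi^{n+1}\|_{l_2}^2=h\sum_{j=0}^{M-1}|\Phi_j^{n+1}|^2=h\sum_{j=0}^{M-1}|\Phi_0(x_j)|^2$ for all $n\ge 0$.
   Context: $\sigma_1=\begin{pmatrix}0&1\\1&0\end{pmatrix}$, $\sigma_3=\begin{pmatrix}1&0\\0&-1\end{pmatrix}$, $I_2$ is the $2\times2$ identity, $|\cdot|$ is the Euclidean norm on $\mathbb C^2$. The equation is $i\epsilon\partial_t\Phi=[-i\epsilon\sigma_1\partial_x+\sigma_3+V(x)I_2-A_1(x)\sigma_1]\Phi$ on $(a,b)$ with periodic boundary conditions and $\Phi(0,\cdot)=\Phi_0$. Grid: $M$ is an even positive integer, $h=(b-a)/M$, $x_j=a+jh$ $(0\le j\le M-1)$, $\tau>0$ is the time step, $\mu_l=2\pi l/(b-a)$ for $-M/2\le l\le M/2-1$. For grid values $U=(U_0,\dots,U_{M-1})$, $U_j\in\mathbb C^2$, $\|U\|_{l_2}=\big(h\sum_{j=0}^{M-1}|U_j|^2\big)^{1/2}$ and $\hat U_l=\frac1M\sum_{j=0}^{M-1}U_je^{-i\mu_l(x_j-a)}$.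 For $s>0$ let $e^{sT}$ act on grid vectors by $U\mapsto\Big(\sum_{l=-M/2}^{M/2-1}e^{s(-i\mu_l\sigma_1-\frac i\epsilon\sigma_3)}\hat U_le^{i\mu_l(x_j-a)}\Big)_{j}$ (the Fourier discretization of the flow of $T=-\sigma_1\partial_x-\frac i\epsilon\sigma_3$), and let exponentials of matrix-valued multiplication operators act by multiplying the $j$-th entry by the $2\times2$ matrix exponential evaluated at $x_j$. Put $W(x)=-\frac i\epsilon V(x)I_2+\frac i\epsilon A_1(x)\sigma_1$. Both schemes start from $\Phi^0_j=\Phi_0(x_j)$. Scheme $S_2$: $\Phi^{n+1}=e^{\frac\tau2W}e^{\tau T}e^{\frac\tau2W}\Phi^n$. Scheme $S_{4c}$: $\Phi^{n+1}=e^{\frac16\tau W}e^{\frac\tau2T}e^{\frac23\tau W+\frac{\tau^3}{72}[W,[T,W]]}e^{\frac\tau2T}e^{\frac16\tau W}\Phi^n$, where $[X,Y]=XY-YX$; in one dimension $[W,[T,W]]$ is multiplication by the matrix $-\frac{4i}{\epsilon^3}A_1(x)^2\sigma_3$. *)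

theory Defs
  imports "HOL-Analysis.Analysis"
begin

text \<open>
  On \<^typ>\<open>complex^2^2\<close> the library operations \<open>*\<close>, \<open>^\<close> and \<open>1\<close> are componentwise, and the class of
  \<^const>\<open>exp\<close> is not available.  Powers and the exponential are therefore built from
  \<^const>\<open>matrix_matrix_mult\<close> and \<open>mat 1\<close>.
\<close>

definition cscale :: "complex \<Rightarrow> complex^2^2 \<Rightarrow> complex^2^2"  (infixr \<open>*\<^sub>m\<close> 75)
  where "c *\<^sub>m A = (\<chi> i j. c * A $ i $ j)"

definition matpow :: "complex^2^2 \<Rightarrow> nat \<Rightarrow> complex^2^2"
  where "matpow A k = (((**) A) ^^ k) (mat 1)"

definition matexp :: "complex^2^2 \<Rightarrow> complex^2^2"
  where "matexp A = (\<Sum>k. matpow A k /\<^sub>R fact k)"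

definition \<sigma>1 :: "complex^2^2"
  where "\<sigma>1 = vector [vector [0, 1], vector [1, 0]]"

definition \<sigma>3 :: "complex^2^2"
  where "\<sigma>3 = vector [vector [1, 0], vector [0, -1]]"

definition W :: "real \<Rightarrow> (real \<Rightarrow> real) \<Rightarrow> (real \<Rightarrow> real) \<Rightarrow> real \<Rightarrow> complex^2^2"
  where "W \<epsilon> V A\<^sub>1 x = (- \<i> / \<epsilon> * V x) *\<^sub>m mat 1 + (\<i> / \<epsilon> * A\<^sub>1 x) *\<^sub>m \<sigma>1"

text \<open>
  The operator \<open>[W,[T,W]]\<close> is multiplication by this matrix; see \<open>WTW_eq_double_commutator\<close> below.
\<close>

definition WTW :: "real \<Rightarrow> (real \<Rightarrow> real) \<Rightarrow> real \<Rightarrow> complex^2^2"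
  where "WTW \<epsilon> A\<^sub>1 x = (- (4 * \<i> / \<epsilon> ^ 3 * (A\<^sub>1 x)\<^sup>2)) *\<^sub>m \<sigma>3"


subsection \<open>Grid functions\<close>

text \<open>
  A grid function is a \<^typ>\<open>nat \<Rightarrow> complex^2\<close>, of which only the entries \<open>j < M\<close> are used.
\<close>

definition mesh :: "real \<Rightarrow> real \<Rightarrow> nat \<Rightarrow> real"
  where "mesh a b M = (b - a) / M"

definition gridpt :: "real \<Rightarrow> real \<Rightarrow> nat \<Rightarrow> nat \<Rightarrow> real"
  where "gridpt a b M j = a + j * mesh a b M"

definition l2norm :: "real \<Rightarrow> real \<Rightarrow> nat \<Rightarrow> (nat \<Rightarrow> complex^2) \<Rightarrow> real"
  where "l2norm a b M U = sqrt (mesh a b M * (\<Sum>j<M. (norm (U j))\<^sup>2))"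

definition freq :: "real \<Rightarrow> real \<Rightarrow> int \<Rightarrow> real"
  where "freq a b l = 2 * pi * l / (b - a)"

definition fourier_coeff :: "real \<Rightarrow> real \<Rightarrow> nat \<Rightarrow> (nat \<Rightarrow> complex^2) \<Rightarrow> int \<Rightarrow> complex^2"
  where "fourier_coeff a b M U l =
    (1 / of_nat M) *s (\<Sum>j<M. exp (- \<i> * freq a b l * (gridpt a b M j - a)) *s U j)"

definition exp_T :: "real \<Rightarrow> real \<Rightarrow> nat \<Rightarrow> real \<Rightarrow> real \<Rightarrow> (nat \<Rightarrow> complex^2) \<Rightarrow> nat \<Rightarrow> complex^2"
  where "exp_T a b M \<epsilon> s U j =
    (\<Sum>l = - (int M div 2)..int M div 2 - 1.
       exp (\<i> * freq a b l * (gridpt a b M j - a)) *s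
       (matexp (s *\<^sub>m ((- \<i> * freq a b l) *\<^sub>m \<sigma>1 - (\<i> / \<epsilon>) *\<^sub>m \<sigma>3)) *v fourier_coeff a b M U l))"

definition exp_mult ::
  "real \<Rightarrow> real \<Rightarrow> nat \<Rightarrow> (real \<Rightarrow> complex^2^2) \<Rightarrow> (nat \<Rightarrow> complex^2) \<Rightarrow> nat \<Rightarrow> complex^2"
  where "exp_mult a b M G U j = matexp (G (gridpt a b M j)) *v U j"


subsection \<open>The splitting schemes\<close>

definition S2_step ::
  "real \<Rightarrow> real \<Rightarrow> nat \<Rightarrow> real \<Rightarrow> real \<Rightarrow> (real \<Rightarrow> real) \<Rightarrow> (real \<Rightarrow> real) \<Rightarrow>
   (nat \<Rightarrow> complex^2) \<Rightarrow> nat \<Rightarrow> complex^2"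
  where "S2_step a b M \<epsilon> \<tau> V A\<^sub>1 =
    exp_mult a b M (\<lambda>x. (\<tau> / 2) *\<^sub>m W \<epsilon> V A\<^sub>1 x) \<circ>
    exp_T a b M \<epsilon> \<tau> \<circ>
    exp_mult a b M (\<lambda>x. (\<tau> / 2) *\<^sub>m W \<epsilon> V A\<^sub>1 x)"

definition S4c_step ::
  "real \<Rightarrow> real \<Rightarrow> nat \<Rightarrow> real \<Rightarrow> real \<Rightarrow> (real \<Rightarrow> real) \<Rightarrow> (real \<Rightarrow> real) \<Rightarrow>
   (nat \<Rightarrow> complex^2) \<Rightarrow> nat \<Rightarrow> complex^2"
  where "S4c_step a b M \<epsilon> \<tau> V A\<^sub>1 =
    exp_mult a b M (\<lambda>x. (\<tau> / 6) *\<^sub>m W \<epsilon> V A\<^sub>1 x) \<circ>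
    exp_T a b M \<epsilon> (\<tau> / 2) \<circ>
    exp_mult a b M (\<lambda>x. (2 / 3 * \<tau>) *\<^sub>m W \<epsilon> V A\<^sub>1 x + (\<tau> ^ 3 / 72) *\<^sub>m WTW \<epsilon> A\<^sub>1 x) \<circ>
    exp_T a b M \<epsilon> (\<tau> / 2) \<circ>
    exp_mult a b M (\<lambda>x. (\<tau> / 6) *\<^sub>m W \<epsilon> V A\<^sub>1 x)"

definition S2 ::
  "real \<Rightarrow> real \<Rightarrow> nat \<Rightarrow> real \<Rightarrow> real \<Rightarrow> (real \<Rightarrow> real) \<Rightarrow> (real \<Rightarrow> real) \<Rightarrow> (real \<Rightarrow> complex^2) \<Rightarrow>
   nat \<Rightarrow> nat \<Rightarrow> complex^2"
  where "S2 a b M \<epsilon> \<tau> V A\<^sub>1 \<Phi>\<^sub>0 n = (S2_step a b M \<epsilon> \<tau> V A\<^sub>1 ^^ n) (\<lambda>j. \<Phi>\<^sub>0 (gridpt a b M j))"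

definition S4c ::
  "real \<Rightarrow> real \<Rightarrow> nat \<Rightarrow> real \<Rightarrow> real \<Rightarrow> (real \<Rightarrow> real) \<Rightarrow> (real \<Rightarrow> real) \<Rightarrow> (real \<Rightarrow> complex^2) \<Rightarrow>
   nat \<Rightarrow> nat \<Rightarrow> complex^2"
  where "S4c a b M \<epsilon> \<tau> V A\<^sub>1 \<Phi>\<^sub>0 n = (S4c_step a b M \<epsilon> \<tau> V A\<^sub>1 ^^ n) (\<lambda>j. \<Phi>\<^sub>0 (gridpt a b M j))"


subsection \<open>The double commutator\<close>

text \<open>
  The schemes use only values of the potentials at grid points, so they are defined without any
  smoothness assumption.  Where the potentials are differentiable, \<^const>\<open>WTW\<close> is the double
  commutator of the operators \<open>T\<close> and \<open>W\<close> on spinor-valued functions.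
\<close>

definition T_op :: "real \<Rightarrow> (real \<Rightarrow> complex^2) \<Rightarrow> real \<Rightarrow> complex^2"
  where "T_op \<epsilon> f x = - (\<sigma>1 *v vector_derivative f (at x)) - (\<i> / \<epsilon>) *\<^sub>m \<sigma>3 *v f x"

definition W_op ::
  "real \<Rightarrow> (real \<Rightarrow> real) \<Rightarrow> (real \<Rightarrow> real) \<Rightarrow> (real \<Rightarrow> complex^2) \<Rightarrow> real \<Rightarrow> complex^2"
  where "W_op \<epsilon> V A\<^sub>1 f x = W \<epsilon> V A\<^sub>1 x *v f x"

definition commutator ::
  "((real \<Rightarrow> complex^2) \<Rightarrow> real \<Rightarrow> complex^2) \<Rightarrow> ((real \<Rightarrow> complex^2) \<Rightarrow> real \<Rightarrow> complex^2) \<Rightarrow>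
   (real \<Rightarrow> complex^2) \<Rightarrow> real \<Rightarrow> complex^2"
  where "commutator X Y f x = X (Y f) x - Y (X f) x"

lemma W_mult_vec:
  "W \<epsilon> V A\<^sub>1 x *v v =
    vector [- \<i> / \<epsilon> * V x * v $ 1 + \<i> / \<epsilon> * A\<^sub>1 x * v $ 2,
            - \<i> / \<epsilon> * V x * v $ 2 + \<i> / \<epsilon> * A\<^sub>1 x * v $ 1]"
  by (simp add: vec_eq_iff forall_2 W_def cscale_def \<sigma>1_def mat_def matrix_vector_mult_def sum_2)

lemma \<sigma>1_mult_vec: "\<sigma>1 *v v = vector [v $ 2, v $ 1]"
  by (simp add: vec_eq_iff forall_2 \<sigma>1_def matrix_vector_mult_def sum_2)

lemma \<sigma>3_mult_vec: "c *\<^sub>m \<sigma>3 *v v = vector [c * v $ 1, - (c * v $ 2)]"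
  by (simp add: vec_eq_iff forall_2 \<sigma>3_def cscale_def matrix_vector_mult_def sum_2)

lemma vector_derivative_W_op:
  assumes "(V has_real_derivative V') (at x)" "(A\<^sub>1 has_real_derivative A') (at x)"
    and "(f has_vector_derivative f') (at x)"
  shows "(W_op \<epsilon> V A\<^sub>1 f has_vector_derivative
            (W \<epsilon> (\<lambda>_. V') (\<lambda>_. A') x *v f x + W \<epsilon> V A\<^sub>1 x *v f')) (at x)"
proof -
  have comp: "((\<lambda>x. f x $ i) has_vector_derivative f' $ i) (at x)" for i
    using bounded_linear.has_vector_derivative[OF bounded_linear_vec_nth assms(3)] .
  have V: "((\<lambda>x. complex_of_real (V x)) has_vector_derivative of_real V') (at x)"
    and A: "((\<lambda>x. complex_of_real (A\<^sub>1 x)) has_vector_derivative of_real A') (at x)"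
    using assms(1,2) by (auto intro: has_vector_derivative_of_real)
  have D: "((\<lambda>x. c * V x * f x $ i + d * A\<^sub>1 x * f x $ k) has_vector_derivative
      (c * V' * f x $ i + d * A' * f x $ k) + (c * V x * f' $ i + d * A\<^sub>1 x * f' $ k)) (at x)"
    for c d :: complex and i k
    by (rule has_vector_derivative_eq_rhs,
        rule has_vector_derivative_add
          [OF has_vector_derivative_mult[OF has_vector_derivative_mult_right[OF V] comp]
              has_vector_derivative_mult[OF has_vector_derivative_mult_right[OF A] comp]])
       (simp add: algebra_simps)
  have "((\<lambda>y. W_op \<epsilon> V A\<^sub>1 f y $ i) has_vector_derivative
          (W \<epsilon> (\<lambda>_. V') (\<lambda>_. A') x *v f x + W \<epsilon> V A\<^sub>1 x *v f') $ i) (at x)" for i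
    using exhaust_2[of i] D[of "- \<i> / \<epsilon>" 1 "\<i> / \<epsilon>" 2] D[of "- \<i> / \<epsilon>" 2 "\<i> / \<epsilon>" 1]
    by (auto simp: W_op_def W_mult_vec)
  then have "((\<lambda>y. W_op \<epsilon> V A\<^sub>1 f y $ i \<bullet> u) has_derivative
      (\<lambda>t. (t *\<^sub>R (W \<epsilon> (\<lambda>_. V') (\<lambda>_. A') x *v f x + W \<epsilon> V A\<^sub>1 x *v f') $ i) \<bullet> u)) (at x)" for i u
    unfolding has_vector_derivative_def by (rule has_derivative_inner_left)
  then show ?thesis
    unfolding has_vector_derivative_def
    by (subst has_derivative_componentwise_within) (auto simp: Basis_vec_def inner_axis)
qed

lemma WTW_eq_double_commutator:
  assumes "V differentiable (at x)" "A\<^sub>1 differentiable (at x)" "f differentiable (at x)"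
  shows "commutator (W_op \<epsilon> V A\<^sub>1) (commutator (T_op \<epsilon>) (W_op \<epsilon> V A\<^sub>1)) f x = WTW \<epsilon> A\<^sub>1 x *v f x"
proof -
  obtain V' A' where V: "(V has_real_derivative V') (at x)" and A: "(A\<^sub>1 has_real_derivative A') (at x)"
    using assms(1,2) by (auto simp: real_differentiable_def)
  have f: "(f has_vector_derivative vector_derivative f (at x)) (at x)"
    using assms(3) by (simp add: vector_derivative_works)
  note Wf = vector_derivative_W_op[OF V A f]
  note WWf = vector_derivative_W_op[OF V A Wf]
  show ?thesis
    unfolding commutator_def T_op_def vector_derivative_at[OF Wf] vector_derivative_at[OF WWf]
    by (simp add: commutator_def T_op_def vector_derivative_at[OF Wf] W_op_def WTW_def W_mult_vec
          \<sigma>1_mult_vec \<sigma>3_mult_vec vec_eq_iff forall_2)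
       (simp add: divide_inverse algebra_simps power2_eq_square power3_eq_cube)
qed

end

theory Submission
  imports Defs
begin

text \<open>
  Every factor of either scheme is the exponential of a skew-Hermitian matrix, applied either
  pointwise or to the Fourier coefficients.  Such an exponential is an isometry: expanding
  \<open>\<langle>e\<^sup>A x, e\<^sup>A x\<rangle>\<close> as a Cauchy product and moving all powers of \<open>A\<close> to one side leaves
  \<open>\<Sum>\<^sub>n \<langle>x, A\<^sup>n x\<rangle> (1 - 1)\<^sup>n / n!\<close>, of which only the term \<open>n = 0\<close> survives.  The discrete
  Fourier transform and its inverse are isometries up to reciprocal factors, because the characters of
  \<open>\<int>/M\<close> are orthogonal.
\<close>

section \<open>Exponential series of skew-adjoint maps\<close>

text \<open>The exponential series of an operator bound dominates. An abstract linear
  \<open>f\<close> covers both left multiplication of matrices and their action on vectors.\<close>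

lemma summable_norm_exp_linear:
  fixes f :: "'a::euclidean_space \<Rightarrow> 'a"
  assumes "linear f"
  shows "summable (\<lambda>k. norm ((f ^^ k) x /\<^sub>R fact k))"
proof -
  obtain B where B: "\<And>x. norm (f x) \<le> B * norm x" "B > 0"
    using linear_bounded_pos[OF assms] by blast
  have bound: "norm ((f ^^ k) x) \<le> B ^ k * norm x" for k
  proof (induction k)
    case (Suc k)
    have "norm ((f ^^ Suc k) x) \<le> B * norm ((f ^^ k) x)"
      using B(1) by simp
    also have "\<dots> \<le> B * (B ^ k * norm x)"
      using Suc B(2) by (intro mult_left_mono) auto
    finally show ?case by (simp add: mult.assoc)
  qed simp
  have "summable (\<lambda>k. (B ^ k /\<^sub>R fact k) * norm x)"
    by (intro summable_mult2 summable_exp_generic)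
  then show ?thesis
    by (rule summable_comparison_test')
       (use bound in \<open>simp add: divide_inverse_commute mult.assoc mult_left_mono\<close>)
qed

lemma inner_skew_funpow:
  fixes f :: "'a::real_inner \<Rightarrow> 'a"
  assumes "\<And>x y. f x \<bullet> y = - (x \<bullet> f y)"
  shows "(f ^^ j) x \<bullet> y = (-1) ^ j * (x \<bullet> (f ^^ j) y)"
proof (induction j arbitrary: y)
  case (Suc j)
  have "(f ^^ Suc j) x \<bullet> y = - ((f ^^ j) x \<bullet> f y)"
    using assms by simp
  then show ?case
    by (simp add: Suc.IH funpow_swap1)
qed simp

text \<open>Each coordinate in \<open>Basis\<close> gives an ordinary Cauchy product of real series;
  the finitely many coordinate identities are then added up.\<close>

lemma Cauchy_product_sums_inner:
  fixes x y :: "nat \<Rightarrow> 'a::euclidean_space"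
  assumes "summable (\<lambda>k. norm (x k))" "summable (\<lambda>k. norm (y k))"
  shows "(\<lambda>n. \<Sum>j\<le>n. x j \<bullet> y (n - j)) sums ((\<Sum>k. x k) \<bullet> (\<Sum>k. y k))"
proof -
  have comp: "summable (\<lambda>k. norm (z k \<bullet> e))" "(\<Sum>k. z k \<bullet> e) = (\<Sum>k. z k) \<bullet> e"
    if "summable (\<lambda>k. norm (z k))" "e \<in> Basis" for z :: "nat \<Rightarrow> 'a" and e
  proof -
    show "summable (\<lambda>k. norm (z k \<bullet> e))"
      by (rule summable_comparison_test'[OF that(1)]) (simp add: Basis_le_norm that(2))
    show "(\<Sum>k. z k \<bullet> e) = (\<Sum>k. z k) \<bullet> e"
      using bounded_linear.suminf[OF bounded_linear_inner_left summable_norm_cancel[OF that(1)]]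
      by simp
  qed
  have "(\<lambda>n. \<Sum>e\<in>Basis. \<Sum>j\<le>n. (x j \<bullet> e) * (y (n - j) \<bullet> e)) sums
      (\<Sum>e\<in>Basis. ((\<Sum>k. x k) \<bullet> e) * ((\<Sum>k. y k) \<bullet> e))"
    using Cauchy_product_sums[OF comp(1)[OF assms(1)] comp(1)[OF assms(2)]]
    by (intro sums_sum) (simp add: comp(2)[OF assms(1)] comp(2)[OF assms(2)])
  moreover have "(\<Sum>e\<in>Basis. \<Sum>j\<le>n. (x j \<bullet> e) * (y (n - j) \<bullet> e)) = (\<Sum>j\<le>n. x j \<bullet> y (n - j))" for n
    by (subst sum.swap) (simp add: euclidean_inner[of "x j" "y (n - j)" for j])
  ultimately show ?thesis
    by (simp add: euclidean_inner[of "suminf x" "suminf y"])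
qed

lemma norm_exp_skew:
  fixes f :: "'a::euclidean_space \<Rightarrow> 'a"
  assumes "linear f" and skew: "\<And>x y. f x \<bullet> y = - (x \<bullet> f y)"
  shows "norm (\<Sum>k. (f ^^ k) x /\<^sub>R fact k) = norm x"
proof -
  let ?t = "\<lambda>k. (f ^^ k) x /\<^sub>R fact k"
  have term_eq: "(\<Sum>j\<le>n. ?t j \<bullet> ?t (n - j)) = (if n = 0 then x \<bullet> x else 0)" for n
  proof -
    \<comment> \<open>Skewness moves \<open>j\<close> copies of \<open>f\<close> across the inner
      product at the cost of a sign; 1/(j! (n-j)!) = (n choose j)/n! supplies the binomial
      coefficient.\<close>
    have "?t j \<bullet> ?t (n - j) = (x \<bullet> (f ^^ n) x) / fact n * ((-1) ^ j * of_nat (n choose j))"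
      if "j \<le> n" for j
    proof -
      have "(f ^^ j) x \<bullet> (f ^^ (n - j)) x = (-1) ^ j * (x \<bullet> (f ^^ n) x)"
        using inner_skew_funpow[OF skew, of j x "(f ^^ (n - j)) x"] that
        by (simp flip: funpow_add[THEN fun_cong, unfolded o_def])
      then show ?thesis
        using that by (simp add: binomial_fact field_simps)
    qed
    then have "(\<Sum>j\<le>n. ?t j \<bullet> ?t (n - j)) =
        (x \<bullet> (f ^^ n) x) / fact n * (\<Sum>j\<le>n. (-1) ^ j * of_nat (n choose j))"
      by (simp add: sum_distrib_left)
    \<comment> \<open>The alternating binomial sum vanishes only for n > 0; for n = 0 the single
      term is \<open>x \<bullet> x\<close>.\<close>
    then show ?thesis
      using choose_alternating_sum[of n, where 'a = real] by (cases "n = 0") simp_all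
  qed
  have "(\<lambda>n. if n = 0 then x \<bullet> x else 0) sums (suminf ?t \<bullet> suminf ?t)"
    using Cauchy_product_sums_inner[OF summable_norm_exp_linear summable_norm_exp_linear,
        OF assms(1) assms(1), of x x]
    by (simp only: term_eq)
  moreover have "(\<lambda>n::nat. if n = 0 then x \<bullet> x else 0) sums (x \<bullet> x)"
    using sums_single[of 0 "\<lambda>_. x \<bullet> x"] by simp
  ultimately have "suminf ?t \<bullet> suminf ?t = x \<bullet> x"
    by (rule sums_unique2)
  then show ?thesis
    by (simp add: norm_eq_sqrt_inner)
qed

section \<open>Matrix exponentials and skew-Hermitian matrices\<close>

lemma linear_matrix_mult_left:
  fixes A :: "'a::real_algebra_1^'n^'m"
  shows "linear ((**) A :: 'a^'k^'n \<Rightarrow> _)"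
  by (rule linearI)
     (simp_all add: vec_eq_iff matrix_matrix_mult_def distrib_left sum.distrib scaleR_sum_right)

lemma linear_matrix_vector_mult:
  fixes A :: "'a::real_algebra_1^'n^'m"
  shows "linear ((*v) A)"
  by (rule linearI)
     (simp_all add: vec_eq_iff matrix_vector_mult_def distrib_left sum.distrib scaleR_sum_right)

lemma linear_matrix_vector_mult_arg:
  fixes x :: "'a::real_algebra_1^'n"
  shows "linear (\<lambda>A :: 'a^'n^'m. A *v x)"
  by (rule linearI)
     (simp_all add: vec_eq_iff matrix_vector_mult_def distrib_right sum.distrib scaleR_sum_right)

lemma matpow_mult_vec: "matpow A k *v x = (((*v) A) ^^ k) x"
  by (induction k) (simp_all add: matpow_def flip: matrix_vector_mul_assoc)

text \<open>Applying a matrix to a fixed vector is bounded linear in the matrix, so it commutes with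
  the convergent series. The result is the vector series treated by
  \<open>norm_exp_skew\<close>.\<close>

lemma matexp_mult_vec: "matexp A *v x = (\<Sum>k. (((*v) A) ^^ k) x /\<^sub>R fact k)"
proof -
  have "summable (\<lambda>k. matpow A k /\<^sub>R fact k)"
    unfolding matpow_def
    by (rule summable_norm_cancel[OF summable_norm_exp_linear[OF linear_matrix_mult_left]])
  from bounded_linear.suminf[OF linear_conv_bounded_linear[THEN iffD1,
        OF linear_matrix_vector_mult_arg] this, of x]
  show ?thesis
    by (simp add: matexp_def linear_scale[OF linear_matrix_vector_mult_arg] matpow_mult_vec)
qed

definition skew_hermitian :: "complex^'n^'n \<Rightarrow> bool"
  where "skew_hermitian A \<longleftrightarrow> (\<forall>i j. cnj (A $ i $ j) = - A $ j $ i)"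

text \<open>Here \<open>\<bullet>\<close> is the real part of the Hermitian product. It induces the
  same norm, so skew-adjointness with respect to it suffices for the isometry.\<close>

lemma inner_skew_hermitian:
  assumes "skew_hermitian A"
  shows "(A *v x) \<bullet> y = - (x \<bullet> (A *v y))"
proof -
  have entry: "(A $ i $ j * x $ j) \<bullet> y $ i = - (x $ j \<bullet> (A $ j $ i * y $ i))" for i j
  proof -
    have "A $ j $ i = - cnj (A $ i $ j)"
      using assms by (simp add: skew_hermitian_def)
    then show ?thesis
      by (simp add: inner_complex_def algebra_simps)
  qed
  have "(A *v x) \<bullet> y = (\<Sum>i\<in>UNIV. \<Sum>j\<in>UNIV. (A $ i $ j * x $ j) \<bullet> y $ i)"
    by (simp add: inner_vec_def matrix_vector_mult_def inner_sum_left)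
  also have "\<dots> = - (\<Sum>j\<in>UNIV. \<Sum>i\<in>UNIV. x $ j \<bullet> (A $ j $ i * y $ i))"
    by (subst sum.swap) (simp add: entry sum_negf)
  also have "\<dots> = - (x \<bullet> (A *v y))"
    by (simp add: inner_vec_def matrix_vector_mult_def inner_sum_right)
  finally show ?thesis .
qed

lemma norm_matexp_skew_hermitian:
  assumes "skew_hermitian A"
  shows "norm (matexp A *v x) = norm x"
  unfolding matexp_mult_vec
  by (rule norm_exp_skew[OF linear_matrix_vector_mult inner_skew_hermitian[OF assms]])

lemma skew_hermitian_add: "skew_hermitian A \<Longrightarrow> skew_hermitian B \<Longrightarrow> skew_hermitian (A + B)"
  by (simp add: skew_hermitian_def)

lemma skew_hermitian_of_real_cscale: "skew_hermitian A \<Longrightarrow> skew_hermitian (of_real r *\<^sub>m A)"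
  by (simp add: skew_hermitian_def cscale_def)

text \<open>The matrices here and in the next two lemmas are i times Hermitian ones: all other
  coefficients are real, and \<open>\<sigma>1\<close>, \<open>\<sigma>3\<close> and
  \<open>mat 1\<close> are real symmetric.\<close>

lemma skew_hermitian_W: "skew_hermitian (W \<epsilon> V A\<^sub>1 x)"
  by (simp add: skew_hermitian_def forall_2 W_def cscale_def \<sigma>1_def mat_def)

lemma skew_hermitian_WTW: "skew_hermitian (WTW \<epsilon> A\<^sub>1 x)"
  by (simp add: skew_hermitian_def forall_2 WTW_def cscale_def \<sigma>3_def)

lemma skew_hermitian_T_symbol:
  "skew_hermitian ((- \<i> * of_real \<mu>) *\<^sub>m \<sigma>1 - (\<i> / of_real \<epsilon>) *\<^sub>m \<sigma>3)"
  by (simp add: skew_hermitian_def forall_2 cscale_def \<sigma>1_def \<sigma>3_def)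

section \<open>Orthogonality of characters and the discrete Fourier transform\<close>

text \<open>Parseval's identity with weight \<open>N\<close>. The index types are kept general
  because it serves twice: for sums over frequencies at each grid point, and for sums over grid
  points at each frequency.\<close>

lemma norm_sum_orthogonal:
  fixes c :: "'l \<Rightarrow> 'j \<Rightarrow> complex" and d :: "'l \<Rightarrow> complex^'n"
  assumes "finite L"
    and orth: "\<And>l l'. l \<in> L \<Longrightarrow> l' \<in> L \<Longrightarrow>
      (\<Sum>j\<in>J. c l j * cnj (c l' j)) = (if l = l' then of_real N else 0)"
  shows "(\<Sum>j\<in>J. (norm (\<Sum>l\<in>L. c l j *s d l))\<^sup>2) = N * (\<Sum>l\<in>L. (norm (d l))\<^sup>2)"
proof -
  \<comment> \<open>One component at a time, |w|^2 = w * cnj w is expanded in the complex numbers;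
    orthogonality removes the off-diagonal terms.\<close>
  have scalar: "(\<Sum>j\<in>J. (norm (\<Sum>l\<in>L. c l j * z l))\<^sup>2) = N * (\<Sum>l\<in>L. (norm (z l))\<^sup>2)" for z
  proof -
    have "of_real (\<Sum>j\<in>J. (norm (\<Sum>l\<in>L. c l j * z l))\<^sup>2) =
        (\<Sum>j\<in>J. \<Sum>l\<in>L. \<Sum>l'\<in>L. (c l j * z l) * cnj (c l' j * z l'))"
      unfolding of_real_sum complex_norm_square by (simp add: sum_product)
    also have "\<dots> = (\<Sum>l\<in>L. \<Sum>l'\<in>L. \<Sum>j\<in>J. (c l j * z l) * cnj (c l' j * z l'))"
      by (subst sum.swap, intro sum.cong refl, subst sum.swap) simp
    also have "\<dots> = (\<Sum>l\<in>L. \<Sum>l'\<in>L. (z l * cnj (z l')) * (\<Sum>j\<in>J. c l j * cnj (c l' j)))"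
      by (simp add: sum_distrib_left mult_ac)
    also have "\<dots> = (\<Sum>l\<in>L. \<Sum>l'\<in>L. if l = l' then of_real N * (z l * cnj (z l')) else 0)"
      by (intro sum.cong refl) (simp add: orth)
    also have "\<dots> = of_real (N * (\<Sum>l\<in>L. (norm (z l))\<^sup>2))"
      using assms(1)
      unfolding of_real_mult of_real_sum complex_norm_square by (simp add: sum_distrib_left)
    finally show ?thesis
      by (simp only: of_real_eq_iff)
  qed
  have norm_sq: "(norm v)\<^sup>2 = (\<Sum>i\<in>UNIV. (norm (v $ i))\<^sup>2)" for v :: "complex^'n"
    by (simp add: norm_vec_def L2_set_def sum_nonneg)
  have "(\<Sum>j\<in>J. (norm (\<Sum>l\<in>L. c l j *s d l))\<^sup>2) =
      (\<Sum>i\<in>UNIV. \<Sum>j\<in>J. (norm (\<Sum>l\<in>L. c l j * d l $ i))\<^sup>2)"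
    by (subst sum.swap) (simp add: norm_sq)
  also have "\<dots> = N * (\<Sum>i\<in>UNIV. \<Sum>l\<in>L. (norm (d l $ i))\<^sup>2)"
    by (simp add: scalar sum_distrib_left)
  also have "\<dots> = N * (\<Sum>l\<in>L. (norm (d l))\<^sup>2)"
    by (subst sum.swap) (simp add: norm_sq)
  finally show ?thesis .
qed

text \<open>A geometric sum with ratio z = e^(2 pi i k/M): z^M = 1 always, while z = 1 exactly when
  M divides k.\<close>

lemma sum_cis_period:
  fixes k :: int
  assumes "0 < M"
  shows "(\<Sum>m<M. cis (2 * pi * k * real m / M)) = (if int M dvd k then of_nat M else 0)"
proof -
  define z where "z = cis (2 * pi * k / M)"
  have pow: "cis (2 * pi * k * real m / M) = z ^ m" for m
    by (simp add: z_def Complex.DeMoivre mult_ac)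
  have "z = 1 \<longleftrightarrow> (\<exists>n::int. 2 * pi * k / M = of_int (2 * n) * pi)"
    by (simp add: z_def cis_conv_exp exp_eq_1)
  also have "\<dots> \<longleftrightarrow> (\<exists>n::int. real_of_int k = of_int (int M * n))"
    using assms by (simp add: field_simps)
  also have "\<dots> \<longleftrightarrow> int M dvd k"
    unfolding of_int_eq_iff dvd_def ..
  finally have z1: "z = 1 \<longleftrightarrow> int M dvd k" .
  have "z ^ M = cis (2 * pi * k)"
    using assms by (simp add: z_def Complex.DeMoivre)
  also have "\<dots> = 1"
    by (simp add: cis_multiple_2pi)
  finally have "z ^ M = 1" .
  with z1 show ?thesis
    by (cases "z = 1") (simp_all add: pow geometric_sum)
qed

text \<open>Evenness of \<open>M\<close> enters here: for odd \<open>M\<close> the centered range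
  would hold only M - 1 frequencies.\<close>

lemma bij_betw_centered_range:
  assumes "even M"
  shows "bij_betw (\<lambda>m. int m - int M div 2) {..<M} {- (int M div 2)..int M div 2 - 1}"
  using assms
  by (intro bij_betwI[where g = "\<lambda>l. nat (l + int M div 2)"]) auto

text \<open>Zero is the only multiple of \<open>M\<close> of absolute value below \<open>M\<close>.
  This excludes aliasing among the frequencies and among the grid indices.\<close>

lemma dvd_diff_eq_iff_less:
  fixes k l :: int
  assumes "\<bar>k - l\<bar> < int M"
  shows "int M dvd k - l \<longleftrightarrow> k = l"
  using assms dvd_imp_le_int[of "k - l" "int M"] by auto

lemma exp_freq:
  assumes "a < b"
  shows "exp (\<i> * freq a b l * (gridpt a b M j - a)) = cis (2 * pi * l * j / M)"
proof -
  have "freq a b l * (gridpt a b M j - a) = 2 * pi * l * j / M"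
    using assms by (simp add: freq_def gridpt_def mesh_def)
  then show ?thesis
    by (simp only: cis_conv_exp mult.assoc flip: of_real_mult)
qed

text \<open>Synthesis and analysis each contribute a factor M by Parseval, cancelled by the squared
  normalization 1/M^2 of the coefficients. In between, each mode is multiplied by an
  isometry.\<close>

lemma sum_exp_T:
  assumes "a < b" "0 < M" "even M"
  shows "(\<Sum>j<M. (norm (exp_T a b M \<epsilon> s U j))\<^sup>2) = (\<Sum>j<M. (norm (U j))\<^sup>2)"
proof -
  define L where "L = {- (int M div 2)..int M div 2 - 1}"
  define E where "E l j = cis (2 * pi * real_of_int l * real j / real M)" for l :: int and j :: nat
  define R where "R l = matexp (s *\<^sub>m ((- \<i> * freq a b l) *\<^sub>m \<sigma>1 - (\<i> / \<epsilon>) *\<^sub>m \<sigma>3))" for l :: int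
  have orth_L: "(\<Sum>j<M. E l j * cnj (E l' j)) = (if l = l' then of_real M else 0)"
    if "l \<in> L" "l' \<in> L" for l l'
  proof -
    have "E l j * cnj (E l' j) = cis (2 * pi * of_int (l - l') * j / M)" for j
      by (simp add: E_def cis_cnj cis_mult diff_divide_distrib algebra_simps)
    moreover have "\<bar>l - l'\<bar> < int M"
      using that assms by (auto simp: L_def)
    ultimately show ?thesis
      by (simp add: sum_cis_period[OF assms(2)] dvd_diff_eq_iff_less del: of_int_diff)
  qed
  \<comment> \<open>The dual relation, summed over frequencies. The outer conjugations are kept
    because the analysis step uses the family \<open>cnj (E l j)\<close>.\<close>
  have orth_J: "(\<Sum>l\<in>L. cnj (E l j) * cnj (cnj (E l j'))) = (if j = j' then of_real M else 0)"
    if "j \<in> {..<M}" "j' \<in> {..<M}" for j j'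
  proof -
    define \<kappa> where "\<kappa> = int j' - int j"
    have "(\<Sum>l\<in>L. cnj (E l j) * cnj (cnj (E l j'))) =
        (\<Sum>l\<in>L. cis (2 * pi * \<kappa> * l / M))"
      by (simp add: E_def cis_cnj cis_mult diff_divide_distrib algebra_simps \<kappa>_def)
    also have "\<dots> = (\<Sum>m<M. cis (2 * pi * \<kappa> * of_int (int m - int M div 2) / M))"
      unfolding L_def by (rule sum.reindex_bij_betw[OF bij_betw_centered_range[OF assms(3)], symmetric])
    \<comment> \<open>Shifting the frequencies to start at 0 costs only a phase independent of
      \<open>m\<close>. It multiplies a zero sum if j and j' differ, and equals 1 if they agree, as
      then \<open>\<kappa>\<close> is 0.\<close>
    also have "\<dots> = (\<Sum>m<M. cis (2 * pi * \<kappa> * real m / M)) * cis (- (2 * pi * \<kappa> * of_int (int M div 2) / M))"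
      by (simp add: sum_distrib_right cis_mult diff_divide_distrib right_diff_distrib)
    also have "\<dots> = (if j = j' then of_real M else 0)"
    proof -
      have "int M dvd \<kappa> \<longleftrightarrow> j = j'"
        using that by (auto simp: \<kappa>_def dvd_diff_eq_iff_less)
      moreover have "j = j' \<Longrightarrow> \<kappa> = 0"
        by (simp add: \<kappa>_def)
      ultimately show ?thesis
        by (cases "j = j'") (simp_all add: sum_cis_period[OF assms(2)])
    qed
    finally show ?thesis .
  qed
  have coeff: "fourier_coeff a b M U l = (1 / of_nat M) *s (\<Sum>j<M. cnj (E l j) *s U j)" for l
  proof -
    have "exp (- \<i> * freq a b l * (gridpt a b M j - a)) = cnj (E l j)" for j
    proof -
      have "exp (- \<i> * freq a b l * (gridpt a b M j - a)) =
          cnj (exp (\<i> * freq a b l * (gridpt a b M j - a)))"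
        by (simp add: exp_cnj)
      then show ?thesis
        by (simp only: exp_freq[OF assms(1)] E_def)
    qed
    then show ?thesis
      by (simp only: fourier_coeff_def)
  qed
  have norm_coeff: "(norm (fourier_coeff a b M U l))\<^sup>2 =
      (norm (\<Sum>j<M. cnj (E l j) *s U j))\<^sup>2 / (real M)\<^sup>2" for l
  proof -
    have "(1 / of_nat M :: complex) *s v = (1 / real M) *\<^sub>R v" for v :: "complex^2"
      by (simp add: vec_eq_iff) (simp add: scaleR_conv_of_real)
    then show ?thesis
      unfolding coeff by (simp add: power_divide)
  qed
  have skew: "norm (R l *v v) = norm v" for l v
    unfolding R_def
    by (intro norm_matexp_skew_hermitian skew_hermitian_of_real_cscale skew_hermitian_T_symbol)
  have "(\<Sum>j<M. (norm (exp_T a b M \<epsilon> s U j))\<^sup>2) =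
      (\<Sum>j<M. (norm (\<Sum>l\<in>L. E l j *s (R l *v fourier_coeff a b M U l)))\<^sup>2)"
    unfolding exp_T_def exp_freq[OF assms(1)] L_def E_def R_def ..
  also have "\<dots> = real M * (\<Sum>l\<in>L. (norm (R l *v fourier_coeff a b M U l))\<^sup>2)"
    using orth_L by (intro norm_sum_orthogonal) (auto simp: L_def)
  also have "\<dots> = (\<Sum>l\<in>L. (norm (\<Sum>j<M. cnj (E l j) *s U j))\<^sup>2) / real M"
    using assms(2)
    by (simp add: skew norm_coeff flip: sum_divide_distrib) (simp add: power2_eq_square)
  \<comment> \<open>Parseval again, with the roles of frequencies and grid points exchanged.\<close>
  also have "(\<Sum>l\<in>L. (norm (\<Sum>j<M. cnj (E l j) *s U j))\<^sup>2) = real M * (\<Sum>j<M. (norm (U j))\<^sup>2)"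
    using norm_sum_orthogonal[of "{..<M}" "\<lambda>j l. cnj (E l j)" L "real M" U] orth_J by simp
  finally show ?thesis
    using assms(2) by simp
qed

section \<open>Mass conservation of the schemes\<close>

lemma l2norm_exp_T:
  assumes "a < b" "0 < M" "even M"
  shows "l2norm a b M (exp_T a b M \<epsilon> s U) = l2norm a b M U"
  by (simp add: l2norm_def sum_exp_T[OF assms])

lemma l2norm_exp_mult:
  assumes "\<And>x. skew_hermitian (G x)"
  shows "l2norm a b M (exp_mult a b M G U) = l2norm a b M U"
  by (simp add: l2norm_def exp_mult_def norm_matexp_skew_hermitian[OF assms])

lemma l2norm_S2_step:
  assumes "a < b" "0 < M" "even M"
  shows "l2norm a b M (S2_step a b M \<epsilon> \<tau> V A\<^sub>1 U) = l2norm a b M U"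
  unfolding S2_step_def o_apply
  by (simp only: l2norm_exp_T[OF assms] l2norm_exp_mult skew_hermitian_of_real_cscale skew_hermitian_W)

text \<open>The commutator correction keeps the middle exponent a real combination of skew-Hermitian
  matrices, so its exponential is still an isometry.\<close>

lemma l2norm_S4c_step:
  assumes "a < b" "0 < M" "even M"
  shows "l2norm a b M (S4c_step a b M \<epsilon> \<tau> V A\<^sub>1 U) = l2norm a b M U"
  unfolding S4c_step_def o_apply
  by (simp only: l2norm_exp_T[OF assms] l2norm_exp_mult skew_hermitian_of_real_cscale
      skew_hermitian_add skew_hermitian_W skew_hermitian_WTW)

theorem lemma2p2:
  fixes a b \<epsilon> \<tau> :: real and M :: nat
    and V A\<^sub>1 :: "real \<Rightarrow> real" and \<Phi>\<^sub>0 :: "real \<Rightarrow> complex^2"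
  assumes "a < b" and "0 < M" and "even M" and "0 < \<tau>" and "0 < \<epsilon>" and "\<epsilon> \<le> 1"
  shows "\<forall>\<Phi> \<in> {S2 a b M \<epsilon> \<tau> V A\<^sub>1 \<Phi>\<^sub>0, S4c a b M \<epsilon> \<tau> V A\<^sub>1 \<Phi>\<^sub>0}. \<forall>n.
    l2norm a b M (\<Phi> (Suc n)) = l2norm a b M (\<Phi> n) \<and>
    l2norm a b M (\<Phi> n) = l2norm a b M (\<Phi> 0) \<and>
    (l2norm a b M (\<Phi> (Suc n)))\<^sup>2 = mesh a b M * (\<Sum>j<M. (norm (\<Phi> (Suc n) j))\<^sup>2) \<and>
    mesh a b M * (\<Sum>j<M. (norm (\<Phi> (Suc n) j))\<^sup>2) =
      mesh a b M * (\<Sum>j<M. (norm (\<Phi>\<^sub>0 (gridpt a b M j)))\<^sup>2)"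
proof -
  have l2norm_sq: "(l2norm a b M U)\<^sup>2 = mesh a b M * (\<Sum>j<M. (norm (U j))\<^sup>2)" for U
    using assms(1) by (simp add: l2norm_def mesh_def sum_nonneg)
  have conserved: "l2norm a b M ((S ^^ n) U) = l2norm a b M U"
    if "\<And>U. l2norm a b M (S U) = l2norm a b M U" for S n U
    by (induction n) (simp_all add: that)
  \<comment> \<open>Comparing every iterate with the sampled initial datum yields all the norm
    equalities at once; \<open>l2norm_sq\<close> then translates them into sums.\<close>
  have "l2norm a b M (\<Phi> n) = l2norm a b M (\<lambda>j. \<Phi>\<^sub>0 (gridpt a b M j))"
    if "\<Phi> \<in> {S2 a b M \<epsilon> \<tau> V A\<^sub>1 \<Phi>\<^sub>0, S4c a b M \<epsilon> \<tau> V A\<^sub>1 \<Phi>\<^sub>0}" for \<Phi> n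
    using that conserved[OF l2norm_S2_step[OF assms(1-3)]] conserved[OF l2norm_S4c_step[OF assms(1-3)]]
    by (auto simp: S2_def S4c_def)
  then show ?thesis
    by (simp flip: l2norm_sq)
qed

end
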